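(* Let $(\mathbb{C},I,\otimes)$ be a symmetric monoidal po-category. There is a bijection between: 1. the set of ajax functors $1\to\mathbb{C}$ from the terminal monoidal po-category; 2. the set of commutative monoid objects $(c,\mu,\eta)$ in $\mathbb{C}$ such that $\mu$ and $\eta$ are right adjoints; and 3. the set of cocommutative comonoid objects $(c,\delta,\epsilon)$ in $\mathbb{C}$ such that $\delta$ and $\epsilon$ are left adjoints.
   Context: A po-category is a category enriched in posets; po-functors are poset-enriched functors. A symmetric monoidal po-category is a po-category with po-functors $\otimes, I$ whose underlying 1-structures form a symmetric monoidal category. In a po-category, $L\colon c\to d$ is left adjoint to $R\colon d\to c$ if $\mathrm{id}_c\le L;R$ and $R;L\le\mathrm{id}_d$, where $f;g$ means first $f$, then $g$. A po-functor $F\colon\mathbb{C}\to\mathbb{D}$ between symmetric monoidal po-categories is ajax (adjoint-lax) if it is lax symmetric monoidal (laxator naturality squares commute strictly) and its laxators $\rho\colon I\to F(I)$ and $\rho_{c,c'}\colon F(c)\otimes F(c')\to F(c\otimes c')$ are right adjoints in $\mathbb{D}$. *)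

theory Defs
  imports Main "HOL-Library.FuncSet"
begin

section \<open>Po-categories\<close>

text \<open>Composition is in diagrammatic order: \<open>f ;; g\<close> means first \<open>f\<close>, then \<open>g\<close>.
  The relation \<open>\<sqsubseteq>\<close> is only meaningful between parallel arrows.\<close>

record ('o, 'a) po_cat =
  Obj :: "'o set"
  Arr :: "'a set"
  Dom :: "'a \<Rightarrow> 'o"
  Cod :: "'a \<Rightarrow> 'o"
  ident :: "'o \<Rightarrow> 'a"
  comp :: "'a \<Rightarrow> 'a \<Rightarrow> 'a"  (infixl ";;\<index>" 65)
  le :: "'a \<Rightarrow> 'a \<Rightarrow> bool"  (infix "\<sqsubseteq>\<index>" 50)

definition hom :: "('o, 'a, 'm) po_cat_scheme \<Rightarrow> 'o \<Rightarrow> 'o \<Rightarrow> 'a set" where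
  "hom C c d = {f \<in> Arr C. Dom C f = c \<and> Cod C f = d}"

locale po_category =
  fixes C :: "('o, 'a, 'm) po_cat_scheme" (structure)
  assumes Dom_in_Obj: "f \<in> Arr C \<Longrightarrow> Dom C f \<in> Obj C"
    and Cod_in_Obj: "f \<in> Arr C \<Longrightarrow> Cod C f \<in> Obj C"
    and ident_in_hom: "c \<in> Obj C \<Longrightarrow> ident C c \<in> hom C c c"
    and comp_in_hom: "f \<in> hom C a b \<Longrightarrow> g \<in> hom C b c \<Longrightarrow> f ;; g \<in> hom C a c"
    and ident_comp: "f \<in> hom C a b \<Longrightarrow> ident C a ;; f = f"
    and comp_ident: "f \<in> hom C a b \<Longrightarrow> f ;; ident C b = f"
    and comp_assoc: "f \<in> hom C a b \<Longrightarrow> g \<in> hom C b c \<Longrightarrow> h \<in> hom C c d \<Longrightarrow>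
      (f ;; g) ;; h = f ;; (g ;; h)"
    and le_refl: "reflp_on (hom C a b) (le C)"
    and le_trans: "transp_on (hom C a b) (le C)"
    and le_antisym: "antisymp_on (hom C a b) (le C)"
    and comp_mono: "f \<in> hom C a b \<Longrightarrow> f' \<in> hom C a b \<Longrightarrow> g \<in> hom C b c \<Longrightarrow> g' \<in> hom C b c \<Longrightarrow>
      f \<sqsubseteq> f' \<Longrightarrow> g \<sqsubseteq> g' \<Longrightarrow> f ;; g \<sqsubseteq> f' ;; g'"

definition iso :: "('o, 'a, 'm) po_cat_scheme \<Rightarrow> 'o \<Rightarrow> 'o \<Rightarrow> 'a \<Rightarrow> bool" where
  "iso C c d f \<longleftrightarrow> f \<in> hom C c d \<and>
    (\<exists>g \<in> hom C d c. f ;;\<^bsub>C\<^esub> g = ident C c \<and> g ;;\<^bsub>C\<^esub> f = ident C d)"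

definition adjoint :: "('o, 'a, 'm) po_cat_scheme \<Rightarrow> 'o \<Rightarrow> 'o \<Rightarrow> 'a \<Rightarrow> 'a \<Rightarrow> bool" where
  "adjoint C c d L R \<longleftrightarrow> L \<in> hom C c d \<and> R \<in> hom C d c \<and>
    ident C c \<sqsubseteq>\<^bsub>C\<^esub> L ;;\<^bsub>C\<^esub> R \<and> R ;;\<^bsub>C\<^esub> L \<sqsubseteq>\<^bsub>C\<^esub> ident C d"

definition is_left_adjoint :: "('o, 'a, 'm) po_cat_scheme \<Rightarrow> 'a \<Rightarrow> bool" where
  "is_left_adjoint C L \<longleftrightarrow> (\<exists>R. adjoint C (Dom C L) (Cod C L) L R)"

definition is_right_adjoint :: "('o, 'a, 'm) po_cat_scheme \<Rightarrow> 'a \<Rightarrow> bool" where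
  "is_right_adjoint C R \<longleftrightarrow> (\<exists>L. adjoint C (Cod C R) (Dom C R) L R)"

locale po_functor = C: po_category C + D: po_category D
  for C :: "('o, 'a, 'm) po_cat_scheme" and D :: "('p, 'b, 'n) po_cat_scheme" +
  fixes Fo :: "'o \<Rightarrow> 'p" and Fa :: "'a \<Rightarrow> 'b"
  assumes obj_map: "c \<in> Obj C \<Longrightarrow> Fo c \<in> Obj D"
    and arr_map: "f \<in> hom C c d \<Longrightarrow> Fa f \<in> hom D (Fo c) (Fo d)"
    and map_ident: "c \<in> Obj C \<Longrightarrow> Fa (ident C c) = ident D (Fo c)"
    and map_comp: "f \<in> hom C c d \<Longrightarrow> g \<in> hom C d e \<Longrightarrow> Fa (f ;;\<^bsub>C\<^esub> g) = Fa f ;;\<^bsub>D\<^esub> Fa g"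
    and map_mono: "f \<in> hom C c d \<Longrightarrow> g \<in> hom C c d \<Longrightarrow> f \<sqsubseteq>\<^bsub>C\<^esub> g \<Longrightarrow> Fa f \<sqsubseteq>\<^bsub>D\<^esub> Fa g"

definition prod_cat ::
  "('o, 'a, 'm) po_cat_scheme \<Rightarrow> ('p, 'b, 'n) po_cat_scheme \<Rightarrow> ('o \<times> 'p, 'a \<times> 'b) po_cat" where
  "prod_cat C D = \<lparr>
     Obj = Obj C \<times> Obj D,
     Arr = Arr C \<times> Arr D,
     Dom = map_prod (Dom C) (Dom D),
     Cod = map_prod (Cod C) (Cod D),
     ident = map_prod (ident C) (ident D),
     comp = (\<lambda>(f, f') (g, g'). (f ;;\<^bsub>C\<^esub> g, f' ;;\<^bsub>D\<^esub> g')),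
     le = (\<lambda>(f, f') (g, g'). f \<sqsubseteq>\<^bsub>C\<^esub> g \<and> f' \<sqsubseteq>\<^bsub>D\<^esub> g')\<rparr>"


section \<open>Symmetric monoidal po-categories\<close>

record ('o, 'a) sm_po_cat = "('o, 'a) po_cat" +
  unit_obj :: 'o
  tensor_obj :: "'o \<Rightarrow> 'o \<Rightarrow> 'o"  (infixr "\<otimes>\<^sub>o\<index>" 70)
  tensor_arr :: "'a \<Rightarrow> 'a \<Rightarrow> 'a"  (infixr "\<otimes>\<^sub>a\<index>" 70)
  associator :: "'o \<Rightarrow> 'o \<Rightarrow> 'o \<Rightarrow> 'a"
  left_unitor :: "'o \<Rightarrow> 'a"
  right_unitor :: "'o \<Rightarrow> 'a"
  braiding :: "'o \<Rightarrow> 'o \<Rightarrow> 'a"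

text \<open>The po-functor \<open>I : 1 \<rightarrow> C\<close> amounts to the object \<open>unit_obj C\<close>. No
  order condition is imposed on the structure isomorphisms.\<close>

locale sm_po_category = po_category C
  for C :: "('o, 'a, 'm) sm_po_cat_scheme" (structure) +
  assumes unit_in_Obj: "unit_obj C \<in> Obj C"
    and tensor_functor:
      "po_functor (prod_cat C C) C (\<lambda>(c, d). c \<otimes>\<^sub>o d) (\<lambda>(f, g). f \<otimes>\<^sub>a g)"
    and associator_iso: "a \<in> Obj C \<Longrightarrow> b \<in> Obj C \<Longrightarrow> c \<in> Obj C \<Longrightarrow>
      iso C ((a \<otimes>\<^sub>o b) \<otimes>\<^sub>o c) (a \<otimes>\<^sub>o (b \<otimes>\<^sub>o c)) (associator C a b c)"
    and associator_natural:
      "f \<in> hom C a a' \<Longrightarrow> g \<in> hom C b b' \<Longrightarrow> h \<in> hom C c c' \<Longrightarrow>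
      ((f \<otimes>\<^sub>a g) \<otimes>\<^sub>a h) ;; associator C a' b' c' = associator C a b c ;; (f \<otimes>\<^sub>a (g \<otimes>\<^sub>a h))"
    and left_unitor_iso: "a \<in> Obj C \<Longrightarrow> iso C (unit_obj C \<otimes>\<^sub>o a) a (left_unitor C a)"
    and left_unitor_natural: "f \<in> hom C a b \<Longrightarrow>
      (ident C (unit_obj C) \<otimes>\<^sub>a f) ;; left_unitor C b = left_unitor C a ;; f"
    and right_unitor_iso: "a \<in> Obj C \<Longrightarrow> iso C (a \<otimes>\<^sub>o unit_obj C) a (right_unitor C a)"
    and right_unitor_natural: "f \<in> hom C a b \<Longrightarrow>
      (f \<otimes>\<^sub>a ident C (unit_obj C)) ;; right_unitor C b = right_unitor C a ;; f"
    and braiding_in_hom: "a \<in> Obj C \<Longrightarrow> b \<in> Obj C \<Longrightarrow>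
      braiding C a b \<in> hom C (a \<otimes>\<^sub>o b) (b \<otimes>\<^sub>o a)"
    and braiding_natural: "f \<in> hom C a a' \<Longrightarrow> g \<in> hom C b b' \<Longrightarrow>
      (f \<otimes>\<^sub>a g) ;; braiding C a' b' = braiding C a b ;; (g \<otimes>\<^sub>a f)"
    and braiding_symmetric: "a \<in> Obj C \<Longrightarrow> b \<in> Obj C \<Longrightarrow>
      braiding C a b ;; braiding C b a = ident C (a \<otimes>\<^sub>o b)"
    and pentagon: "a \<in> Obj C \<Longrightarrow> b \<in> Obj C \<Longrightarrow> c \<in> Obj C \<Longrightarrow> d \<in> Obj C \<Longrightarrow>
      associator C (a \<otimes>\<^sub>o b) c d ;; associator C a b (c \<otimes>\<^sub>o d) =
      (associator C a b c \<otimes>\<^sub>a ident C d) ;; associator C a (b \<otimes>\<^sub>o c) d ;;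
        (ident C a \<otimes>\<^sub>a associator C b c d)"
    and triangle: "a \<in> Obj C \<Longrightarrow> b \<in> Obj C \<Longrightarrow>
      associator C a (unit_obj C) b ;; (ident C a \<otimes>\<^sub>a left_unitor C b) =
      right_unitor C a \<otimes>\<^sub>a ident C b"
    and hexagon: "a \<in> Obj C \<Longrightarrow> b \<in> Obj C \<Longrightarrow> c \<in> Obj C \<Longrightarrow>
      associator C a b c ;; braiding C a (b \<otimes>\<^sub>o c) ;; associator C b c a =
      (braiding C a b \<otimes>\<^sub>a ident C c) ;; associator C b a c ;;
        (ident C b \<otimes>\<^sub>a braiding C a c)"

definition terminal_sm :: "(unit, unit) sm_po_cat" where
  "terminal_sm = \<lparr>
     Obj = UNIV, Arr = UNIV, Dom = (\<lambda>_. ()), Cod = (\<lambda>_. ()), ident = (\<lambda>_. ()),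
     comp = (\<lambda>_ _. ()), le = (\<lambda>_ _. True),
     unit_obj = (), tensor_obj = (\<lambda>_ _. ()), tensor_arr = (\<lambda>_ _. ()),
     associator = (\<lambda>_ _ _. ()), left_unitor = (\<lambda>_. ()), right_unitor = (\<lambda>_. ()),
     braiding = (\<lambda>_ _. ())\<rparr>"

lemma sm_po_category_terminal_sm: "sm_po_category terminal_sm"
proof -
  have T: "po_category terminal_sm"
    by unfold_locales
      (auto simp: terminal_sm_def hom_def reflp_on_def transp_on_def antisymp_on_def)
  have P: "po_category (prod_cat terminal_sm terminal_sm)"
    by unfold_locales
      (auto simp: prod_cat_def terminal_sm_def hom_def reflp_on_def transp_on_def antisymp_on_def)
  have "po_functor (prod_cat terminal_sm terminal_sm) terminal_sm
      (\<lambda>(c, d). tensor_obj terminal_sm c d) (\<lambda>(f, g). tensor_arr terminal_sm f g)"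
    by (intro po_functor.intro T P po_functor_axioms.intro)
      (auto simp: prod_cat_def terminal_sm_def hom_def)
  then show ?thesis
    by (intro sm_po_category.intro T sm_po_category_axioms.intro)
      (auto simp: terminal_sm_def hom_def iso_def)
qed


section \<open>Ajax functors\<close>

record ('o, 'a, 'p, 'b) lax_functor =
  fobj :: "'o \<Rightarrow> 'p"
  farr :: "'a \<Rightarrow> 'b"
  lax_unit :: 'b
  lax_mult :: "'o \<Rightarrow> 'o \<Rightarrow> 'b"

locale lax_sm_po_functor =
  C: sm_po_category C + D: sm_po_category D + po_functor C D "fobj F" "farr F"
  for C :: "('o, 'a, 'm) sm_po_cat_scheme" and D :: "('p, 'b, 'n) sm_po_cat_scheme"
    and F :: "('o, 'a, 'p, 'b) lax_functor" +
  assumes lax_unit_in_hom: "lax_unit F \<in> hom D (unit_obj D) (fobj F (unit_obj C))"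
    and lax_mult_in_hom: "a \<in> Obj C \<Longrightarrow> b \<in> Obj C \<Longrightarrow>
      lax_mult F a b \<in> hom D (fobj F a \<otimes>\<^sub>o\<^bsub>D\<^esub> fobj F b) (fobj F (a \<otimes>\<^sub>o\<^bsub>C\<^esub> b))"
    and lax_mult_natural: "f \<in> hom C a a' \<Longrightarrow> g \<in> hom C b b' \<Longrightarrow>
      (farr F f \<otimes>\<^sub>a\<^bsub>D\<^esub> farr F g) ;;\<^bsub>D\<^esub> lax_mult F a' b' =
      lax_mult F a b ;;\<^bsub>D\<^esub> farr F (f \<otimes>\<^sub>a\<^bsub>C\<^esub> g)"
    and lax_associative: "a \<in> Obj C \<Longrightarrow> b \<in> Obj C \<Longrightarrow> c \<in> Obj C \<Longrightarrow>
      (lax_mult F a b \<otimes>\<^sub>a\<^bsub>D\<^esub> ident D (fobj F c)) ;;\<^bsub>D\<^esub> lax_mult F (a \<otimes>\<^sub>o\<^bsub>C\<^esub> b) c ;;\<^bsub>D\<^esub>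
        farr F (associator C a b c) =
      associator D (fobj F a) (fobj F b) (fobj F c) ;;\<^bsub>D\<^esub>
        (ident D (fobj F a) \<otimes>\<^sub>a\<^bsub>D\<^esub> lax_mult F b c) ;;\<^bsub>D\<^esub> lax_mult F a (b \<otimes>\<^sub>o\<^bsub>C\<^esub> c)"
    and lax_left_unital: "a \<in> Obj C \<Longrightarrow>
      (lax_unit F \<otimes>\<^sub>a\<^bsub>D\<^esub> ident D (fobj F a)) ;;\<^bsub>D\<^esub> lax_mult F (unit_obj C) a ;;\<^bsub>D\<^esub>
        farr F (left_unitor C a) = left_unitor D (fobj F a)"
    and lax_right_unital: "a \<in> Obj C \<Longrightarrow>
      (ident D (fobj F a) \<otimes>\<^sub>a\<^bsub>D\<^esub> lax_unit F) ;;\<^bsub>D\<^esub> lax_mult F a (unit_obj C) ;;\<^bsub>D\<^esub>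
        farr F (right_unitor C a) = right_unitor D (fobj F a)"
    and lax_symmetric: "a \<in> Obj C \<Longrightarrow> b \<in> Obj C \<Longrightarrow>
      lax_mult F a b ;;\<^bsub>D\<^esub> farr F (braiding C a b) =
      braiding D (fobj F a) (fobj F b) ;;\<^bsub>D\<^esub> lax_mult F b a"

locale ajax_functor = lax_sm_po_functor C D F
  for C :: "('o, 'a, 'm) sm_po_cat_scheme" and D :: "('p, 'b, 'n) sm_po_cat_scheme"
    and F :: "('o, 'a, 'p, 'b) lax_functor" +
  assumes lax_unit_adjoint: "is_right_adjoint D (lax_unit F)"
    and lax_mult_adjoint: "a \<in> Obj C \<Longrightarrow> b \<in> Obj C \<Longrightarrow> is_right_adjoint D (lax_mult F a b)"

text \<open>The extensionality conditions make HOL equality of functor records agree with equality of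
  functors: the component functions carry no information outside \<open>Obj C\<close> and \<open>Arr C\<close>.\<close>

definition ajax_functors ::
  "('o, 'a, 'm) sm_po_cat_scheme \<Rightarrow> ('p, 'b, 'n) sm_po_cat_scheme \<Rightarrow>
    ('o, 'a, 'p, 'b) lax_functor set" where
  "ajax_functors C D = {F. ajax_functor C D F \<and>
     fobj F \<in> extensional (Obj C) \<and> farr F \<in> extensional (Arr C) \<and>
     (\<lambda>(a, b). lax_mult F a b) \<in> extensional (Obj C \<times> Obj C)}"


section \<open>Commutative monoids and cocommutative comonoids\<close>

definition comm_monoid_object :: "('o, 'a, 'm) sm_po_cat_scheme \<Rightarrow> 'o \<Rightarrow> 'a \<Rightarrow> 'a \<Rightarrow> bool" where
  "comm_monoid_object C c \<mu> \<eta> \<longleftrightarrow>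
     c \<in> Obj C \<and> \<mu> \<in> hom C (c \<otimes>\<^sub>o\<^bsub>C\<^esub> c) c \<and> \<eta> \<in> hom C (unit_obj C) c \<and>
     (\<mu> \<otimes>\<^sub>a\<^bsub>C\<^esub> ident C c) ;;\<^bsub>C\<^esub> \<mu> = associator C c c c ;;\<^bsub>C\<^esub> (ident C c \<otimes>\<^sub>a\<^bsub>C\<^esub> \<mu>) ;;\<^bsub>C\<^esub> \<mu> \<and>
     (\<eta> \<otimes>\<^sub>a\<^bsub>C\<^esub> ident C c) ;;\<^bsub>C\<^esub> \<mu> = left_unitor C c \<and>
     (ident C c \<otimes>\<^sub>a\<^bsub>C\<^esub> \<eta>) ;;\<^bsub>C\<^esub> \<mu> = right_unitor C c \<and>
     braiding C c c ;;\<^bsub>C\<^esub> \<mu> = \<mu>"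

definition cocomm_comonoid_object :: "('o, 'a, 'm) sm_po_cat_scheme \<Rightarrow> 'o \<Rightarrow> 'a \<Rightarrow> 'a \<Rightarrow> bool" where
  "cocomm_comonoid_object C c \<delta> \<epsilon> \<longleftrightarrow>
     c \<in> Obj C \<and> \<delta> \<in> hom C c (c \<otimes>\<^sub>o\<^bsub>C\<^esub> c) \<and> \<epsilon> \<in> hom C c (unit_obj C) \<and>
     \<delta> ;;\<^bsub>C\<^esub> (\<delta> \<otimes>\<^sub>a\<^bsub>C\<^esub> ident C c) ;;\<^bsub>C\<^esub> associator C c c c = \<delta> ;;\<^bsub>C\<^esub> (ident C c \<otimes>\<^sub>a\<^bsub>C\<^esub> \<delta>) \<and>
     \<delta> ;;\<^bsub>C\<^esub> (\<epsilon> \<otimes>\<^sub>a\<^bsub>C\<^esub> ident C c) ;;\<^bsub>C\<^esub> left_unitor C c = ident C c \<and>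
     \<delta> ;;\<^bsub>C\<^esub> (ident C c \<otimes>\<^sub>a\<^bsub>C\<^esub> \<epsilon>) ;;\<^bsub>C\<^esub> right_unitor C c = ident C c \<and>
     \<delta> ;;\<^bsub>C\<^esub> braiding C c c = \<delta>"

definition right_adjoint_comm_monoids ::
  "('o, 'a, 'm) sm_po_cat_scheme \<Rightarrow> ('o \<times> 'a \<times> 'a) set" where
  "right_adjoint_comm_monoids C = {(c, \<mu>, \<eta>).
     comm_monoid_object C c \<mu> \<eta> \<and> is_right_adjoint C \<mu> \<and> is_right_adjoint C \<eta>}"

definition left_adjoint_cocomm_comonoids ::
  "('o, 'a, 'm) sm_po_cat_scheme \<Rightarrow> ('o \<times> 'a \<times> 'a) set" where
  "left_adjoint_cocomm_comonoids C = {(c, \<delta>, \<epsilon>).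
     cocomm_comonoid_object C c \<delta> \<epsilon> \<and> is_left_adjoint C \<delta> \<and> is_left_adjoint C \<epsilon>}"

end

theory Submission imports Defs begin

text \<open>
  A functor out of the terminal category preserves identities, so an ajax functor
  \<open>1 \<rightarrow> C\<close> is an object with its laxators, and the lax monoidal laws are the monoid laws.
  For the second bijection, taking adjoints reverses composition and commutes with \<open>\<otimes>\<close>. If
  \<open>L \<stileturn> R\<close>, \<open>L' \<stileturn> R'\<close> and \<open>i\<close> is invertible, then uniqueness of adjoints gives
  \<open>R = i ;; R'\<close> iff \<open>L ;; i = L'\<close>. Each commutative monoid law has the former shape, where \<open>i\<close>
  is a structure isomorphism, and the corresponding comonoid law has the latter.
\<close>

section \<open>Adjunctions in a po-category\<close>

context po_category
begin

lemma hom_le_refl: "f \<in> hom C a b \<Longrightarrow> f \<sqsubseteq> f"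
  using le_refl[of a b] by (auto simp: reflp_on_def)

lemma hom_le_trans:
  "f \<in> hom C a b \<Longrightarrow> g \<in> hom C a b \<Longrightarrow> h \<in> hom C a b \<Longrightarrow> f \<sqsubseteq> g \<Longrightarrow> g \<sqsubseteq> h \<Longrightarrow> f \<sqsubseteq> h"
  using le_trans[of a b] by (blast dest: transp_onD)

lemma hom_le_antisym:
  "f \<in> hom C a b \<Longrightarrow> g \<in> hom C a b \<Longrightarrow> f \<sqsubseteq> g \<Longrightarrow> g \<sqsubseteq> f \<Longrightarrow> f = g"
  using le_antisym[of a b] by (blast dest: antisymp_onD)

lemma hom_Obj: "f \<in> hom C a b \<Longrightarrow> a \<in> Obj C \<and> b \<in> Obj C"
  using Dom_in_Obj Cod_in_Obj by (auto simp: hom_def)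

text \<open>Unit of the second adjunction, hypothesis, and counit of the first give the chain
  \<open>L \<sqsubseteq> L' ;; R' ;; L \<sqsubseteq> L' ;; R ;; L \<sqsubseteq> L'\<close>.\<close>

lemma left_adjoint_antimono:
  assumes "adjoint C a b L R" "adjoint C a b L' R'" "R' \<sqsubseteq> R"
  shows "L \<sqsubseteq> L'"
proof -
  have L: "L \<in> hom C a b" and R: "R \<in> hom C b a" and counit: "R ;; L \<sqsubseteq> ident C b"
    using assms(1) by (auto simp: adjoint_def)
  have L': "L' \<in> hom C a b" and R': "R' \<in> hom C b a" and unit: "ident C a \<sqsubseteq> L' ;; R'"
    using assms(2) by (auto simp: adjoint_def)
  have id: "ident C a \<in> hom C a a" "ident C b \<in> hom C b b"
    using hom_Obj[OF L] ident_in_hom by auto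
  have "ident C a ;; L \<sqsubseteq> (L' ;; R') ;; L"
    using comp_mono[OF id(1) comp_in_hom[OF L' R'] L L unit hom_le_refl[OF L]] .
  then have 1: "L \<sqsubseteq> L' ;; (R' ;; L)"
    using ident_comp[OF L] comp_assoc[OF L' R' L] by simp
  have "R' ;; L \<sqsubseteq> R ;; L"
    using comp_mono[OF R' R L L assms(3) hom_le_refl[OF L]] .
  then have "R' ;; L \<sqsubseteq> ident C b"
    using hom_le_trans[OF comp_in_hom[OF R' L] comp_in_hom[OF R L] id(2)] counit by blast
  then have "L' ;; (R' ;; L) \<sqsubseteq> L' ;; ident C b"
    using comp_mono[OF L' L' comp_in_hom[OF R' L] id(2) hom_le_refl[OF L']] by blast
  then have "L' ;; (R' ;; L) \<sqsubseteq> L'"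
    using comp_ident[OF L'] by simp
  then show ?thesis
    using hom_le_trans[OF L comp_in_hom[OF L' comp_in_hom[OF R' L]] L' 1] by blast
qed

text \<open>Here the unit of the first adjunction and the counit of the second are used: \<open>R'
  \<sqsubseteq> R' ;; L ;; R \<sqsubseteq> R' ;; L' ;; R \<sqsubseteq> R\<close>.\<close>

lemma right_adjoint_antimono:
  assumes "adjoint C a b L R" "adjoint C a b L' R'" "L \<sqsubseteq> L'"
  shows "R' \<sqsubseteq> R"
proof -
  have L: "L \<in> hom C a b" and R: "R \<in> hom C b a" and unit: "ident C a \<sqsubseteq> L ;; R"
    using assms(1) by (auto simp: adjoint_def)
  have L': "L' \<in> hom C a b" and R': "R' \<in> hom C b a" and counit: "R' ;; L' \<sqsubseteq> ident C b"
    using assms(2) by (auto simp: adjoint_def)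
  have id: "ident C a \<in> hom C a a" "ident C b \<in> hom C b b"
    using hom_Obj[OF L] ident_in_hom by auto
  have "R' ;; ident C a \<sqsubseteq> R' ;; (L ;; R)"
    using comp_mono[OF R' R' id(1) comp_in_hom[OF L R] hom_le_refl[OF R'] unit] .
  then have 1: "R' \<sqsubseteq> (R' ;; L) ;; R"
    using comp_ident[OF R'] comp_assoc[OF R' L R] by simp
  have "R' ;; L \<sqsubseteq> R' ;; L'"
    using comp_mono[OF R' R' L L' hom_le_refl[OF R'] assms(3)] .
  then have "R' ;; L \<sqsubseteq> ident C b"
    using hom_le_trans[OF comp_in_hom[OF R' L] comp_in_hom[OF R' L'] id(2)] counit by blast
  then have "(R' ;; L) ;; R \<sqsubseteq> ident C b ;; R"
    using comp_mono[OF comp_in_hom[OF R' L] id(2) R R _ hom_le_refl[OF R]] by blast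
  then have "(R' ;; L) ;; R \<sqsubseteq> R"
    using ident_comp[OF R] by simp
  then show ?thesis
    using hom_le_trans[OF R' comp_in_hom[OF comp_in_hom[OF R' L] R] R 1] by blast
qed

text \<open>Equal arrows are comparable in both directions, so antimonotonicity compares their
  adjoints in both directions, and antisymmetry of the hom-posets yields equality on the nose. This
  makes choosing an adjoint harmless and lets equations pass between left and right
  adjoints.\<close>

lemma adjoint_eq_iff:
  assumes "adjoint C a b L R" "adjoint C a b L' R'"
  shows "R = R' \<longleftrightarrow> L = L'"
proof -
  have homs: "L \<in> hom C a b" "L' \<in> hom C a b" "R \<in> hom C b a" "R' \<in> hom C b a"
    using assms by (auto simp: adjoint_def)
  show ?thesis
  proof
    assume "R = R'"
    then show "L = L'"
      using left_adjoint_antimono[OF assms] left_adjoint_antimono[OF assms(2,1)]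
        hom_le_antisym[OF homs(1,2)] hom_le_refl[OF homs(3)] by blast
  next
    assume "L = L'"
    then show "R = R'"
      using right_adjoint_antimono[OF assms] right_adjoint_antimono[OF assms(2,1)]
        hom_le_antisym[OF homs(3,4)] hom_le_refl[OF homs(1)] by blast
  qed
qed

lemma adjoint_ident: "a \<in> Obj C \<Longrightarrow> adjoint C a a (ident C a) (ident C a)"
  using ident_in_hom ident_comp hom_le_refl by (fastforce simp: adjoint_def)

text \<open>The unit and counit of one adjunction are nested in those of the other: \<open>ident C a
  \<sqsubseteq> L ;; R \<sqsubseteq> L ;; L' ;; R' ;; R\<close>, and \<open>R' ;; R ;; L ;; L'
  \<sqsubseteq> R' ;; L' \<sqsubseteq> ident C c\<close>.\<close>

lemma adjoint_comp:
  assumes "adjoint C a b L R" "adjoint C b c L' R'"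
  shows "adjoint C a c (L ;; L') (R' ;; R)"
proof -
  have L: "L \<in> hom C a b" and R: "R \<in> hom C b a"
    and u: "ident C a \<sqsubseteq> L ;; R" and v: "R ;; L \<sqsubseteq> ident C b"
    using assms(1) by (auto simp: adjoint_def)
  have L': "L' \<in> hom C b c" and R': "R' \<in> hom C c b"
    and u': "ident C b \<sqsubseteq> L' ;; R'" and v': "R' ;; L' \<sqsubseteq> ident C c"
    using assms(2) by (auto simp: adjoint_def)
  have id: "ident C a \<in> hom C a a" "ident C b \<in> hom C b b" "ident C c \<in> hom C c c"
    using hom_Obj[OF L] hom_Obj[OF L'] ident_in_hom by auto
  note LL = comp_in_hom[OF L L'] and RR = comp_in_hom[OF R' R]
  have "ident C b ;; R \<sqsubseteq> (L' ;; R') ;; R"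
    using comp_mono[OF id(2) comp_in_hom[OF L' R'] R R u' hom_le_refl[OF R]] .
  then have "R \<sqsubseteq> L' ;; (R' ;; R)"
    using ident_comp[OF R] comp_assoc[OF L' R' R] by simp
  then have "L ;; R \<sqsubseteq> L ;; (L' ;; (R' ;; R))"
    using comp_mono[OF L L R comp_in_hom[OF L' RR] hom_le_refl[OF L]] by blast
  then have unit: "ident C a \<sqsubseteq> (L ;; L') ;; (R' ;; R)"
    using hom_le_trans[OF id(1) comp_in_hom[OF L R] comp_in_hom[OF LL RR] u]
      comp_assoc[OF L L' RR] by simp
  have "(R ;; L) ;; L' \<sqsubseteq> ident C b ;; L'"
    using comp_mono[OF comp_in_hom[OF R L] id(2) L' L' v hom_le_refl[OF L']] .
  then have "R ;; (L ;; L') \<sqsubseteq> L'"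
    using ident_comp[OF L'] comp_assoc[OF R L L'] by simp
  then have "R' ;; (R ;; (L ;; L')) \<sqsubseteq> R' ;; L'"
    using comp_mono[OF R' R' comp_in_hom[OF R LL] L' hom_le_refl[OF R']] by blast
  then have "(R' ;; R) ;; (L ;; L') \<sqsubseteq> ident C c"
    using hom_le_trans[OF comp_in_hom[OF RR LL] comp_in_hom[OF R' L'] id(3) _ v']
      comp_assoc[OF R' R LL] by simp
  with unit LL RR show ?thesis
    by (simp add: adjoint_def)
qed

text \<open>The equations of an inverse are in particular the inequalities of an adjunction. The
  inverse is taken as the left adjoint because \<open>i\<close> stands on the side of the right
  adjoints in the monoid laws.\<close>

lemma iso_adjoint:
  assumes "iso C a b i"
  obtains j where "adjoint C b a j i" "i ;; j = ident C a" "j ;; i = ident C b"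
proof -
  obtain j where i: "i \<in> hom C a b" and j: "j \<in> hom C b a"
    and ij: "i ;; j = ident C a" "j ;; i = ident C b"
    using assms by (auto simp: iso_def)
  moreover have "ident C a \<sqsubseteq> ident C a" "ident C b \<sqsubseteq> ident C b"
    using hom_Obj[OF i] ident_in_hom hom_le_refl by blast+
  ultimately show thesis
    using that by (simp add: adjoint_def)
qed

text \<open>With \<open>j\<close> the inverse of \<open>i\<close>, the composite
  \<open>i ;; R'\<close> is right adjoint to \<open>L' ;; j\<close>. Uniqueness of adjoints turns
  the left equation into \<open>L = L' ;; j\<close>, and composing with \<open>i\<close> or
  \<open>j\<close> cancels the isomorphism.\<close>

lemma adjoint_iso_transpose:
  assumes LR: "adjoint C c a L R" and LR': "adjoint C c b L' R'" and i: "iso C a b i"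
  shows "R = i ;; R' \<longleftrightarrow> L ;; i = L'"
proof -
  obtain j where j: "adjoint C b a j i" and ij: "i ;; j = ident C a" "j ;; i = ident C b"
    using iso_adjoint[OF i] .
  have h: "i \<in> hom C a b" "j \<in> hom C b a" "L \<in> hom C c a" "L' \<in> hom C c b"
    using j LR LR' by (auto simp: adjoint_def)
  have "R = i ;; R' \<longleftrightarrow> L = L' ;; j"
    using adjoint_eq_iff[OF LR adjoint_comp[OF LR' j]] .
  also have "\<dots> \<longleftrightarrow> L ;; i = L'"
    using comp_assoc[OF h(4,2,1)] comp_assoc[OF h(3,1,2)] ij comp_ident[OF h(3)] comp_ident[OF h(4)]
    by auto
  finally show ?thesis .
qed

lemma is_right_adjoint_iff:
  "R \<in> hom C d c \<Longrightarrow> is_right_adjoint C R \<longleftrightarrow> (\<exists>L. adjoint C c d L R)"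
  by (auto simp: is_right_adjoint_def hom_def)

lemma is_left_adjoint_iff:
  "L \<in> hom C c d \<Longrightarrow> is_left_adjoint C L \<longleftrightarrow> (\<exists>R. adjoint C c d L R)"
  by (auto simp: is_left_adjoint_def hom_def)

end

section \<open>Functoriality of the tensor product and its effect on adjunctions\<close>

context sm_po_category
begin

lemma tensor_Obj: "a \<in> Obj C \<Longrightarrow> b \<in> Obj C \<Longrightarrow> a \<otimes>\<^sub>o b \<in> Obj C"
  using po_functor.obj_map[OF tensor_functor, of "(a, b)"] by (simp add: prod_cat_def)

lemma hom_prod_cat_iff:
  "(f, g) \<in> hom (prod_cat C C) (a, a') (b, b') \<longleftrightarrow> f \<in> hom C a b \<and> g \<in> hom C a' b'"
  by (auto simp: prod_cat_def hom_def)

lemma tensor_in_hom: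
  "f \<in> hom C a b \<Longrightarrow> g \<in> hom C a' b' \<Longrightarrow> f \<otimes>\<^sub>a g \<in> hom C (a \<otimes>\<^sub>o a') (b \<otimes>\<^sub>o b')"
  using po_functor.arr_map[OF tensor_functor, of "(f, g)" "(a, a')" "(b, b')"]
  by (simp add: hom_prod_cat_iff)

lemma tensor_ident:
  "a \<in> Obj C \<Longrightarrow> b \<in> Obj C \<Longrightarrow> ident C a \<otimes>\<^sub>a ident C b = ident C (a \<otimes>\<^sub>o b)"
  using po_functor.map_ident[OF tensor_functor, of "(a, b)"] by (simp add: prod_cat_def)

lemma tensor_comp:
  assumes "f \<in> hom C a b" "g \<in> hom C b c" "f' \<in> hom C a' b'" "g' \<in> hom C b' c'"
  shows "(f ;; g) \<otimes>\<^sub>a (f' ;; g') = (f \<otimes>\<^sub>a f') ;; (g \<otimes>\<^sub>a g')"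
  using po_functor.map_comp[OF tensor_functor,
      of "(f, f')" "(a, a')" "(b, b')" "(g, g')" "(c, c')"] assms
  by (simp add: hom_prod_cat_iff) (simp add: prod_cat_def)

lemma tensor_mono:
  assumes "f \<in> hom C a b" "g \<in> hom C a b" "f' \<in> hom C a' b'" "g' \<in> hom C a' b'"
    and "f \<sqsubseteq> g" "f' \<sqsubseteq> g'"
  shows "f \<otimes>\<^sub>a f' \<sqsubseteq> g \<otimes>\<^sub>a g'"
  using po_functor.map_mono[OF tensor_functor,
      of "(f, f')" "(a, a')" "(b, b')" "(g, g')"] assms
  by (simp add: hom_prod_cat_iff) (simp add: prod_cat_def)

text \<open>A po-functor preserves adjunctions, and a pair of adjunctions is an adjunction in the
  product category. Concretely, \<open>tensor_mono\<close> combines the two units and the two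
  counits, and \<open>tensor_ident\<close> and \<open>tensor_comp\<close> rewrite both
  sides.\<close>

lemma adjoint_tensor:
  assumes "adjoint C a b L R" "adjoint C a' b' L' R'"
  shows "adjoint C (a \<otimes>\<^sub>o a') (b \<otimes>\<^sub>o b') (L \<otimes>\<^sub>a L') (R \<otimes>\<^sub>a R')"
proof -
  have L: "L \<in> hom C a b" and R: "R \<in> hom C b a"
    and u: "ident C a \<sqsubseteq> L ;; R" and v: "R ;; L \<sqsubseteq> ident C b"
    using assms(1) by (auto simp: adjoint_def)
  have L': "L' \<in> hom C a' b'" and R': "R' \<in> hom C b' a'"
    and u': "ident C a' \<sqsubseteq> L' ;; R'" and v': "R' ;; L' \<sqsubseteq> ident C b'"
    using assms(2) by (auto simp: adjoint_def)
  have ob: "a \<in> Obj C" "b \<in> Obj C" "a' \<in> Obj C" "b' \<in> Obj C"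
    using hom_Obj[OF L] hom_Obj[OF L'] by auto
  have "ident C (a \<otimes>\<^sub>o a') \<sqsubseteq> (L \<otimes>\<^sub>a L') ;; (R \<otimes>\<^sub>a R')"
    using tensor_mono[OF ident_in_hom[OF ob(1)] comp_in_hom[OF L R]
        ident_in_hom[OF ob(3)] comp_in_hom[OF L' R'] u u']
      tensor_ident[OF ob(1,3)] tensor_comp[OF L R L' R'] by simp
  moreover have "(R \<otimes>\<^sub>a R') ;; (L \<otimes>\<^sub>a L') \<sqsubseteq> ident C (b \<otimes>\<^sub>o b')"
    using tensor_mono[OF comp_in_hom[OF R L] ident_in_hom[OF ob(2)]
        comp_in_hom[OF R' L'] ident_in_hom[OF ob(4)] v v']
      tensor_ident[OF ob(2,4)] tensor_comp[OF R L R' L'] by simp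
  ultimately show ?thesis
    using tensor_in_hom[OF L L'] tensor_in_hom[OF R R'] by (simp add: adjoint_def)
qed

section \<open>Commutative monoids and cocommutative comonoids\<close>

lemma braiding_iso: "a \<in> Obj C \<Longrightarrow> b \<in> Obj C \<Longrightarrow> iso C (a \<otimes>\<^sub>o b) (b \<otimes>\<^sub>o a) (braiding C a b)"
  using braiding_in_hom braiding_symmetric by (fastforce simp: iso_def)

text \<open>The laws correspond one by one through \<open>adjoint_iso_transpose\<close>. The left
  adjoint of each composite is computed by \<open>adjoint_comp\<close> and
  \<open>adjoint_tensor\<close>, with the identity of \<open>c\<close> adjoint to itself.\<close>

lemma comm_monoid_iff_cocomm_comonoid:
  assumes \<mu>: "adjoint C c (c \<otimes>\<^sub>o c) \<delta> \<mu>" and \<eta>: "adjoint C c (unit_obj C) \<epsilon> \<eta>"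
  shows "comm_monoid_object C c \<mu> \<eta> \<longleftrightarrow> cocomm_comonoid_object C c \<delta> \<epsilon>"
proof -
  have h: "\<mu> \<in> hom C (c \<otimes>\<^sub>o c) c" "\<eta> \<in> hom C (unit_obj C) c"
    "\<delta> \<in> hom C c (c \<otimes>\<^sub>o c)" "\<epsilon> \<in> hom C c (unit_obj C)"
    using \<mu> \<eta> by (auto simp: adjoint_def)
  have c: "c \<in> Obj C"
    using hom_Obj[OF h(1)] by simp
  note id = adjoint_ident[OF c] and id_hom = ident_in_hom[OF c]
  have iso:
    "iso C ((c \<otimes>\<^sub>o c) \<otimes>\<^sub>o c) (c \<otimes>\<^sub>o (c \<otimes>\<^sub>o c)) (associator C c c c)"
    "iso C (unit_obj C \<otimes>\<^sub>o c) c (left_unitor C c)"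
    "iso C (c \<otimes>\<^sub>o unit_obj C) c (right_unitor C c)"
    using associator_iso left_unitor_iso right_unitor_iso c by auto
  then have iso_hom:
    "associator C c c c \<in> hom C ((c \<otimes>\<^sub>o c) \<otimes>\<^sub>o c) (c \<otimes>\<^sub>o (c \<otimes>\<^sub>o c))"
    "left_unitor C c \<in> hom C (unit_obj C \<otimes>\<^sub>o c) c"
    "right_unitor C c \<in> hom C (c \<otimes>\<^sub>o unit_obj C) c"
    by (auto simp: iso_def)
  have "(\<mu> \<otimes>\<^sub>a ident C c) ;; \<mu> = associator C c c c ;; ((ident C c \<otimes>\<^sub>a \<mu>) ;; \<mu>) \<longleftrightarrow>
      \<delta> ;; (\<delta> \<otimes>\<^sub>a ident C c) ;; associator C c c c = \<delta> ;; (ident C c \<otimes>\<^sub>a \<delta>)"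
    by (rule adjoint_iso_transpose[OF adjoint_comp[OF \<mu> adjoint_tensor[OF \<mu> id]]
          adjoint_comp[OF \<mu> adjoint_tensor[OF id \<mu>]] iso(1)])
  \<comment> \<open>Since \<open>;;\<close> associates to the left, the monoid law has to be
    rebracketed to isolate the associator as the first factor.\<close>
  moreover have "associator C c c c ;; ((ident C c \<otimes>\<^sub>a \<mu>) ;; \<mu>) =
      associator C c c c ;; (ident C c \<otimes>\<^sub>a \<mu>) ;; \<mu>"
    using comp_assoc[OF iso_hom(1) tensor_in_hom[OF id_hom h(1)] h(1)] by simp
  \<comment> \<open>The right-hand side of a unit law is a bare unitor. Composing it with the
    self-adjoint identity gives it the required shape; \<open>comp_ident\<close> removes this factor
    at the end.\<close>
  moreover have "(\<eta> \<otimes>\<^sub>a ident C c) ;; \<mu> = left_unitor C c ;; ident C c \<longleftrightarrow>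
      \<delta> ;; (\<epsilon> \<otimes>\<^sub>a ident C c) ;; left_unitor C c = ident C c"
    by (rule adjoint_iso_transpose[OF adjoint_comp[OF \<mu> adjoint_tensor[OF \<eta> id]] id iso(2)])
  moreover have "(ident C c \<otimes>\<^sub>a \<eta>) ;; \<mu> = right_unitor C c ;; ident C c \<longleftrightarrow>
      \<delta> ;; (ident C c \<otimes>\<^sub>a \<epsilon>) ;; right_unitor C c = ident C c"
    by (rule adjoint_iso_transpose[OF adjoint_comp[OF \<mu> adjoint_tensor[OF id \<eta>]] id iso(3)])
  \<comment> \<open>Commutativity is the case where both adjunctions coincide and the isomorphism is
    the braiding.\<close>
  moreover have "\<mu> = braiding C c c ;; \<mu> \<longleftrightarrow> \<delta> ;; braiding C c c = \<delta>"
    by (rule adjoint_iso_transpose[OF \<mu> \<mu> braiding_iso[OF c c]])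
  ultimately show ?thesis
    using h c comp_ident[OF iso_hom(2)] comp_ident[OF iso_hom(3)]
    unfolding comm_monoid_object_def cocomm_comonoid_object_def by auto
qed

text \<open>The typing of the structure maps fixes their domains and codomains, so the adjoints
  hidden in \<open>is_right_adjoint\<close> can be named at the expected objects. This rule and the
  next three are the interface to the two sets of triples.\<close>

lemma right_adjoint_comm_monoidsE:
  assumes "(c, \<mu>, \<eta>) \<in> right_adjoint_comm_monoids C"
  obtains \<delta> \<epsilon> where "comm_monoid_object C c \<mu> \<eta>"
    "adjoint C c (c \<otimes>\<^sub>o c) \<delta> \<mu>" "adjoint C c (unit_obj C) \<epsilon> \<eta>"
  using assms is_right_adjoint_iff
  by (fastforce simp: right_adjoint_comm_monoids_def comm_monoid_object_def)

lemma left_adjoint_cocomm_comonoidsE: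
  assumes "(c, \<delta>, \<epsilon>) \<in> left_adjoint_cocomm_comonoids C"
  obtains \<mu> \<eta> where "cocomm_comonoid_object C c \<delta> \<epsilon>"
    "adjoint C c (c \<otimes>\<^sub>o c) \<delta> \<mu>" "adjoint C c (unit_obj C) \<epsilon> \<eta>"
  using assms is_left_adjoint_iff
  by (fastforce simp: left_adjoint_cocomm_comonoids_def cocomm_comonoid_object_def)

lemma mem_right_adjoint_comm_monoidsI:
  assumes "comm_monoid_object C c \<mu> \<eta>"
    "adjoint C c (c \<otimes>\<^sub>o c) \<delta> \<mu>" "adjoint C c (unit_obj C) \<epsilon> \<eta>"
  shows "(c, \<mu>, \<eta>) \<in> right_adjoint_comm_monoids C"
  using assms is_right_adjoint_iff
  by (fastforce simp: right_adjoint_comm_monoids_def comm_monoid_object_def)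

lemma mem_left_adjoint_cocomm_comonoidsI:
  assumes "cocomm_comonoid_object C c \<delta> \<epsilon>"
    "adjoint C c (c \<otimes>\<^sub>o c) \<delta> \<mu>" "adjoint C c (unit_obj C) \<epsilon> \<eta>"
  shows "(c, \<delta>, \<epsilon>) \<in> left_adjoint_cocomm_comonoids C"
  using assms is_left_adjoint_iff
  by (fastforce simp: left_adjoint_cocomm_comonoids_def cocomm_comonoid_object_def)

text \<open>The map replaces both structure maps by their left adjoints. Uniqueness of left adjoints
  makes it independent of choices, uniqueness of right adjoints makes it injective, and taking right
  adjoints of a comonoid structure gives preimages.\<close>

lemma ex_bij_betw_comm_monoids_cocomm_comonoids:
  "\<exists>\<Psi>. bij_betw \<Psi> (right_adjoint_comm_monoids C) (left_adjoint_cocomm_comonoids C) \<and>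
    (\<forall>(c, \<mu>, \<eta>) \<in> right_adjoint_comm_monoids C.
       \<exists>\<delta> \<epsilon>. \<Psi> (c, \<mu>, \<eta>) = (c, \<delta>, \<epsilon>) \<and>
         adjoint C c (c \<otimes>\<^sub>o c) \<delta> \<mu> \<and> adjoint C c (unit_obj C) \<epsilon> \<eta>)"
proof -
  define \<Psi> where "\<Psi> = (\<lambda>(c, \<mu>, \<eta>).
    (c, SOME \<delta>. adjoint C c (c \<otimes>\<^sub>o c) \<delta> \<mu>, SOME \<epsilon>. adjoint C c (unit_obj C) \<epsilon> \<eta>))"
  \<comment> \<open>By uniqueness the chosen left adjoints agree with any given ones, so
    \<open>SOME\<close> need not be unfolded again.\<close>
  have \<Psi>_eq: "\<Psi> (c, \<mu>, \<eta>) = (c, \<delta>, \<epsilon>)"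
    if a: "adjoint C c (c \<otimes>\<^sub>o c) \<delta> \<mu>" "adjoint C c (unit_obj C) \<epsilon> \<eta>" for c \<mu> \<eta> \<delta> \<epsilon>
    using adjoint_eq_iff[OF someI[of "\<lambda>L. adjoint C c (c \<otimes>\<^sub>o c) L \<mu>", OF a(1)] a(1)]
      adjoint_eq_iff[OF someI[of "\<lambda>L. adjoint C c (unit_obj C) L \<eta>", OF a(2)] a(2)]
    by (simp add: \<Psi>_def)
  have "bij_betw \<Psi> (right_adjoint_comm_monoids C) (left_adjoint_cocomm_comonoids C)"
  proof (intro bij_betw_imageI inj_onI subset_antisym subsetI)
    fix x y
    assume x: "x \<in> right_adjoint_comm_monoids C" and y: "y \<in> right_adjoint_comm_monoids C"
      and eq: "\<Psi> x = \<Psi> y"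
    obtain c \<mu> \<eta> c' \<mu>' \<eta>' where xy: "x = (c, \<mu>, \<eta>)" "y = (c', \<mu>', \<eta>')"
      by (cases x, cases y)
    obtain \<delta> \<epsilon> where a: "adjoint C c (c \<otimes>\<^sub>o c) \<delta> \<mu>" "adjoint C c (unit_obj C) \<epsilon> \<eta>"
      using right_adjoint_comm_monoidsE x xy(1) by metis
    obtain \<delta>' \<epsilon>' where a': "adjoint C c' (c' \<otimes>\<^sub>o c') \<delta>' \<mu>'" "adjoint C c' (unit_obj C) \<epsilon>' \<eta>'"
      using right_adjoint_comm_monoidsE y xy(2) by metis
    \<comment> \<open>Equal images have equal left adjoints, which determine the right
      adjoints.\<close>
    have "c = c'" "\<delta> = \<delta>'" "\<epsilon> = \<epsilon>'"
      using eq \<Psi>_eq[OF a] \<Psi>_eq[OF a'] xy by auto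
    then show "x = y"
      using adjoint_eq_iff a a' xy by blast
  next
    fix z assume "z \<in> \<Psi> ` right_adjoint_comm_monoids C"
    then obtain c \<mu> \<eta> where m: "(c, \<mu>, \<eta>) \<in> right_adjoint_comm_monoids C" and z: "z = \<Psi> (c, \<mu>, \<eta>)"
      by auto
    then show "z \<in> left_adjoint_cocomm_comonoids C"
      using comm_monoid_iff_cocomm_comonoid mem_left_adjoint_cocomm_comonoidsI \<Psi>_eq
      by (metis right_adjoint_comm_monoidsE)
  next
    fix z assume z: "z \<in> left_adjoint_cocomm_comonoids C"
    obtain c \<delta> \<epsilon> where z_eq: "z = (c, \<delta>, \<epsilon>)"
      by (cases z)
    obtain \<mu> \<eta> where m: "cocomm_comonoid_object C c \<delta> \<epsilon>"
      and a: "adjoint C c (c \<otimes>\<^sub>o c) \<delta> \<mu>" "adjoint C c (unit_obj C) \<epsilon> \<eta>"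
      using left_adjoint_cocomm_comonoidsE z z_eq by metis
    have "(c, \<mu>, \<eta>) \<in> right_adjoint_comm_monoids C"
      using comm_monoid_iff_cocomm_comonoid[OF a] m mem_right_adjoint_comm_monoidsI[OF _ a] by blast
    then show "z \<in> \<Psi> ` right_adjoint_comm_monoids C"
      using \<Psi>_eq[OF a] z_eq by (metis image_eqI)
  qed
  moreover have "\<exists>\<delta> \<epsilon>. \<Psi> (c, \<mu>, \<eta>) = (c, \<delta>, \<epsilon>) \<and>
      adjoint C c (c \<otimes>\<^sub>o c) \<delta> \<mu> \<and> adjoint C c (unit_obj C) \<epsilon> \<eta>"
    if "(c, \<mu>, \<eta>) \<in> right_adjoint_comm_monoids C" for c \<mu> \<eta>
    using that \<Psi>_eq by (metis right_adjoint_comm_monoidsE)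
  ultimately show ?thesis
    by blast
qed

section \<open>Ajax functors out of the terminal category\<close>

lemma ajax_functor_farr:
  assumes "ajax_functor terminal_sm C F"
  shows "farr F () = ident C (fobj F ())"
proof -
  interpret F: ajax_functor terminal_sm C F
    by (rule assms)
  \<comment> \<open>The only arrow of \<open>terminal_sm\<close> is the identity of its only
    object.\<close>
  show ?thesis
    using F.map_ident[of "()"] by (simp add: terminal_sm_def)
qed

lemma ajax_functor_comm_monoid:
  assumes "ajax_functor terminal_sm C F"
  shows "(fobj F (), lax_mult F () (), lax_unit F) \<in> right_adjoint_comm_monoids C"
proof -
  interpret F: ajax_functor terminal_sm C F
    by (rule assms)
  let ?c = "fobj F ()" and ?\<mu> = "lax_mult F () ()" and ?\<eta> = "lax_unit F"
  have c: "?c \<in> Obj C" and \<mu>: "?\<mu> \<in> hom C (?c \<otimes>\<^sub>o ?c) ?c"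
    and \<eta>: "?\<eta> \<in> hom C (unit_obj C) ?c"
    using F.obj_map[of "()"] F.lax_mult_in_hom[of "()" "()"] F.lax_unit_in_hom
    by (auto simp: terminal_sm_def)
  note id = ident_in_hom[OF c] and farr = ajax_functor_farr[OF assms]
  \<comment> \<open>In each coherence law the functor sends the structure arrow of
    \<open>terminal_sm\<close> to an identity, which \<open>comp_ident\<close> cancels; what remains
    is the monoid law.\<close>
  have "(?\<mu> \<otimes>\<^sub>a ident C ?c) ;; ?\<mu> = associator C ?c ?c ?c ;; (ident C ?c \<otimes>\<^sub>a ?\<mu>) ;; ?\<mu>"
    using F.lax_associative[of "()" "()" "()"] comp_ident[OF comp_in_hom[OF tensor_in_hom[OF \<mu> id] \<mu>]]
    by (simp add: terminal_sm_def farr)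
  moreover have "(?\<eta> \<otimes>\<^sub>a ident C ?c) ;; ?\<mu> = left_unitor C ?c"
    using F.lax_left_unital[of "()"] comp_ident[OF comp_in_hom[OF tensor_in_hom[OF \<eta> id] \<mu>]]
    by (simp add: terminal_sm_def farr)
  moreover have "(ident C ?c \<otimes>\<^sub>a ?\<eta>) ;; ?\<mu> = right_unitor C ?c"
    using F.lax_right_unital[of "()"] comp_ident[OF comp_in_hom[OF tensor_in_hom[OF id \<eta>] \<mu>]]
    by (simp add: terminal_sm_def farr)
  moreover have "braiding C ?c ?c ;; ?\<mu> = ?\<mu>"
    using F.lax_symmetric[of "()" "()"] comp_ident[OF \<mu>] by (simp add: terminal_sm_def farr)
  moreover have "is_right_adjoint C ?\<mu>" "is_right_adjoint C ?\<eta>"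
    using F.lax_mult_adjoint[of "()" "()"] F.lax_unit_adjoint by (auto simp: terminal_sm_def)
  ultimately show ?thesis
    using c \<mu> \<eta> by (simp add: right_adjoint_comm_monoids_def comm_monoid_object_def)
qed

lemma comm_monoid_ajax_functor:
  assumes "(c, \<mu>, \<eta>) \<in> right_adjoint_comm_monoids C"
  shows "ajax_functor terminal_sm C
    \<lparr>fobj = \<lambda>_. c, farr = \<lambda>_. ident C c, lax_unit = \<eta>, lax_mult = \<lambda>_ _. \<mu>\<rparr>"
proof -
  have c: "c \<in> Obj C" and \<mu>: "\<mu> \<in> hom C (c \<otimes>\<^sub>o c) c" and \<eta>: "\<eta> \<in> hom C (unit_obj C) c"
    and laws:
      "(\<mu> \<otimes>\<^sub>a ident C c) ;; \<mu> = associator C c c c ;; (ident C c \<otimes>\<^sub>a \<mu>) ;; \<mu>"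
      "(\<eta> \<otimes>\<^sub>a ident C c) ;; \<mu> = left_unitor C c"
      "(ident C c \<otimes>\<^sub>a \<eta>) ;; \<mu> = right_unitor C c"
      "braiding C c c ;; \<mu> = \<mu>"
    and adj: "is_right_adjoint C \<mu>" "is_right_adjoint C \<eta>"
    using assms by (auto simp: right_adjoint_comm_monoids_def comm_monoid_object_def)
  note id = ident_in_hom[OF c]
  note idr = comp_ident[OF comp_in_hom[OF tensor_in_hom[OF \<mu> id] \<mu>]]
    comp_ident[OF comp_in_hom[OF tensor_in_hom[OF \<eta> id] \<mu>]]
    comp_ident[OF comp_in_hom[OF tensor_in_hom[OF id \<eta>] \<mu>]]
    comp_ident[OF \<mu>] comp_ident[OF id]
  have T: "sm_po_category terminal_sm" and P: "po_category terminal_sm"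
    using sm_po_category_terminal_sm sm_po_category.axioms(1) by blast+
  \<comment> \<open>Preservation of composites amounts to idempotence of the identity, and
    monotonicity to reflexivity.\<close>
  have "po_functor terminal_sm C (\<lambda>_. c) (\<lambda>_. ident C c)"
    by (intro po_functor.intro P po_category_axioms po_functor_axioms.intro)
      (use c id idr hom_le_refl in \<open>auto simp: terminal_sm_def\<close>)
  \<comment> \<open>Naturality of the laxator reads \<open>(ident C c \<otimes>\<^sub>a ident C c)
    ;; \<mu> = \<mu> ;; ident C c\<close>, which \<open>tensor_ident\<close> settles. The coherence
    laws are the monoid laws followed by an identity.\<close>
  then show ?thesis
    by (intro ajax_functor.intro lax_sm_po_functor.intro T sm_po_category_axioms
        lax_sm_po_functor_axioms.intro ajax_functor_axioms.intro)
      (use c \<mu> \<eta> laws adj idr tensor_ident[OF c c] ident_comp[OF \<mu>] in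
        \<open>auto simp: terminal_sm_def\<close>)
qed

lemma bij_betw_ajax_functors_comm_monoids:
  "bij_betw (\<lambda>F. (fobj F (), lax_mult F () (), lax_unit F))
    (ajax_functors terminal_sm C) (right_adjoint_comm_monoids C)"
proof (intro bij_betw_imageI inj_onI subset_antisym subsetI)
  fix F G
  assume "F \<in> ajax_functors terminal_sm C" "G \<in> ajax_functors terminal_sm C"
    and eq: "(fobj F (), lax_mult F () (), lax_unit F) = (fobj G (), lax_mult G () (), lax_unit G)"
  then have "farr F () = farr G ()"
    by (simp add: ajax_functors_def ajax_functor_farr)
  \<comment> \<open>A function on \<open>unit\<close> is determined by its value at
    \<open>()\<close>.\<close>
  then have "fobj F = fobj G" "farr F = farr G" "lax_mult F = lax_mult G" "lax_unit F = lax_unit G"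
    using eq by (auto simp: fun_eq_iff)
  then show "F = G"
    by simp
next
  fix x assume "x \<in> (\<lambda>F. (fobj F (), lax_mult F () (), lax_unit F)) ` ajax_functors terminal_sm C"
  then show "x \<in> right_adjoint_comm_monoids C"
    using ajax_functor_comm_monoid by (auto simp: ajax_functors_def)
next
  fix x assume x: "x \<in> right_adjoint_comm_monoids C"
  obtain c \<mu> \<eta> where x_eq: "x = (c, \<mu>, \<eta>)"
    by (cases x)
  let ?F = "\<lparr>fobj = \<lambda>_::unit. c, farr = \<lambda>_::unit. ident C c, lax_unit = \<eta>, lax_mult = \<lambda>_ _. \<mu>\<rparr>"
  \<comment> \<open>The objects and arrows of \<open>terminal_sm\<close> form \<open>UNIV\<close>,
    so every function on them is extensional.\<close>
  have "?F \<in> ajax_functors terminal_sm C"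
    using comm_monoid_ajax_functor x x_eq
    by (auto simp: ajax_functors_def extensional_def terminal_sm_def)
  then show "x \<in> (\<lambda>F. (fobj F (), lax_mult F () (), lax_unit F)) ` ajax_functors terminal_sm C"
    by (rule rev_image_eqI) (simp add: x_eq)
qed

end

text \<open>Both bijections are pinned down by formulas, which says more than equality of
  cardinalities: \<open>\<Phi>\<close> reads off the object and its laxators, and
  \<open>\<Psi>\<close> passes to left adjoints. Composing them relates ajax functors to
  comonoids.\<close>

theorem proposition3p4:
  fixes C :: "('o, 'a, 'm) sm_po_cat_scheme"
  assumes "sm_po_category C"
  shows "\<exists>\<Phi> \<Psi>.
    bij_betw \<Phi> (ajax_functors terminal_sm C) (right_adjoint_comm_monoids C) \<and>
    (\<forall>F \<in> ajax_functors terminal_sm C.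
       \<Phi> F = (fobj F (), lax_mult F () (), lax_unit F)) \<and>
    bij_betw \<Psi> (right_adjoint_comm_monoids C) (left_adjoint_cocomm_comonoids C) \<and>
    (\<forall>(c, \<mu>, \<eta>) \<in> right_adjoint_comm_monoids C.
       \<exists>\<delta> \<epsilon>. \<Psi> (c, \<mu>, \<eta>) = (c, \<delta>, \<epsilon>) \<and>
         adjoint C c (c \<otimes>\<^sub>o\<^bsub>C\<^esub> c) \<delta> \<mu> \<and> adjoint C c (unit_obj C) \<epsilon> \<eta>)"
  using sm_po_category.bij_betw_ajax_functors_comm_monoids[OF assms]
    sm_po_category.ex_bij_betw_comm_monoids_cocomm_comonoids[OF assms] by blast

end
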